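(* Let $q \ge 1$ be an integer and let $a,b,c$ be admissible residue classes modulo $q$. Then $N(x;q,[a,b,c]) \to \infty$ as $x \to \infty$; equivalently, there are infinitely many $n$ with $E_n \equiv a$, $E_{n+1} \equiv b$, $E_{n+2} \equiv c \pmod q$.
   Context: Let $\mathbf E = \{m^2 + l^2 : m,l \text{ nonnegative integers}\}$ be the set of sums of two squares, and let $E_1 < E_2 < E_3 < \cdots$ be its elements listed in increasing order. A residue class $a$ modulo $q$ is called admissible if the congruence $x^2 + y^2 \equiv a \pmod q$ has a solution in integers $x,y$. For an $r$-tuple $\mathbf a = [a_1,\dots,a_r]$ of admissible residue classes modulo $q$, define $N(x;q,\mathbf a) := \#\{E_n \le x : E_{n+i-1} \equiv a_i \pmod q \text{ for all } 1 \le i \le r\}$. *)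

theory Defs
  imports Complex_Main "HOL-Library.Infinite_Set" "HOL-Number_Theory.Cong"
begin

definition sums_two_squares :: "nat set" where
  "sums_two_squares = {m\<^sup>2 + l\<^sup>2 | m l. True}"

text \<open>
  The increasing enumeration is indexed from 1, so that \<open>E_seq 1 = 0\<close> is the least element
  (\<open>enumerate\<close> starts at index 0). By truncated subtraction \<open>E_seq 0 = E_seq 1\<close>,
  so the index 0 is excluded wherever the sequence is used.
\<close>

definition E_seq :: "nat \<Rightarrow> nat" where
  "E_seq n = enumerate sums_two_squares (n - 1)"

definition admissible :: "nat \<Rightarrow> int \<Rightarrow> bool" where
  "admissible q a \<longleftrightarrow> (\<exists>x y :: int. [x\<^sup>2 + y\<^sup>2 = a] (mod int q))"

text \<open>
  The tuple \<open>[a\<^sub>1, \<dots>, a\<^sub>r]\<close> is a list of integer representatives, with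
  \<open>a\<^sub>i\<close> being \<open>as ! (i - 1)\<close>.
\<close>

definition N_count :: "real \<Rightarrow> nat \<Rightarrow> int list \<Rightarrow> nat" where
  "N_count x q as = card {E_seq n | n. 1 \<le> n \<and> real (E_seq n) \<le> x \<and>
     (\<forall>i\<in>{1..length as}. [int (E_seq (n + i - 1)) = as ! (i - 1)] (mod int q))}"

lemma infinite_sums_two_squares: "infinite sums_two_squares"
proof -
  have "range (\<lambda>m::nat. m\<^sup>2) \<subseteq> sums_two_squares"
    unfolding sums_two_squares_def by (force intro: exI[of _ "0::nat"])
  moreover have "inj (\<lambda>m::nat. m\<^sup>2)"
    by (auto intro!: injI)
  ultimately show ?thesis
    using finite_subset range_inj_infinite by blast
qed

lemma E_seq_strict_mono: "1 \<le> m \<Longrightarrow> m < n \<Longrightarrow> E_seq m < E_seq n"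
  unfolding E_seq_def by (intro enumerate_mono infinite_sums_two_squares) simp

lemma E_seq_image: "E_seq ` {1..} = sums_two_squares"
proof -
  have "E_seq ` {1..} = range (enumerate sums_two_squares)"
  proof -
    have "{1::nat..} = range Suc"
      by (auto simp: image_iff Suc_le_eq gr0_conv_Suc)
    then show ?thesis
      by (simp add: image_image E_seq_def)
  qed
  then show ?thesis
    using range_enumerate infinite_sums_two_squares by metis
qed

end

theory Submission
  imports Defs "HOL-Number_Theory.Number_Theory"
begin

text \<open>
  Let three integer points \<open>P\<close>, \<open>P + d\<^sub>1\<close>, \<open>P + d\<^sub>2\<close> have squared norms \<open>N\<close>, \<open>N + h\<close>, \<open>N + g\<close>. For given
  \<open>d\<^sub>1\<close>, \<open>d\<^sub>2\<close> this is a linear system for \<open>P\<close> with determinant \<open>2 det (d\<^sub>1, d\<^sub>2)\<close>, so new triples with the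
  same \<open>h\<close>, \<open>g\<close> arise by replacing \<open>(d\<^sub>1, d\<^sub>2)\<close> by \<open>W (d\<^sub>1, d\<^sub>2)\<close> for suitable integer matrices \<open>W\<close>. Choosing
  \<open>W\<close> congruent to the identity modulo \<open>2 det (d\<^sub>1, d\<^sub>2) M\<close> preserves \<open>N\<close> modulo \<open>M\<close>, while the residue of
  \<open>W\<close> modulo \<open>p\<^sup>2\<close> can be prescribed for a large prime \<open>p \<equiv> 3 (mod 4)\<close> so that \<open>N + j \<equiv> p (mod p\<^sup>2)\<close>; then
  \<open>N + j\<close> is not a sum of two squares. This prescription forces the residue of \<open>l = det W\<close> modulo \<open>p\<^sup>2\<close>; the
  system stays solvable modulo \<open>l\<close> if \<open>P\<close> is the midpoint of the other two points modulo \<open>l\<close>, that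
  is \<open>d\<^sub>2 \<equiv> - d\<^sub>1\<close> and \<open>2 \<bar>d\<^sub>1\<bar>\<^sup>2 \<equiv> h + g (mod l)\<close>, and the latter is possible when \<open>l = u\<^sup>2 + v\<^sup>2\<close> with
  coprime \<open>u\<close>, \<open>v\<close>. Running through all \<open>0 < j < g\<close>, \<open>j \<noteq> h\<close>, makes the three sums of two squares
  consecutive.
\<close>

section \<open>Primes congruent to 3 modulo 4 and residues modulo their squares\<close>

text \<open>Euclid's argument: a number congruent to 3 modulo 4 has a prime factor of the same kind,
  and a prime factor of \<open>4 * fact (nat B) - 1\<close> exceeds \<open>B\<close>.\<close>

lemma prime_3_mod_4_beyond: "\<exists>p::int. prime p \<and> p mod 4 = 3 \<and> p > B"
proof -
  have aux: "\<exists>p. prime p \<and> p dvd n \<and> p mod 4 = 3" if "n mod 4 = 3" for n :: nat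
    using that
  proof (induction n rule: less_induct)
    case (less n)
    then have "n \<noteq> 1" by auto
    then obtain p where p: "prime p" "p dvd n"
      using prime_factor_nat by blast
    then obtain k where k: "n = p * k" by blast
    have pos: "n > 0" using less.prems by (cases n) auto
    consider "p mod 4 = 0" | "p mod 4 = 1" | "p mod 4 = 2" | "p mod 4 = 3" by linarith
    then show ?case
    proof cases
      case 2
      have "k mod 4 = 3"
        using less.prems 2 k mod_mult_left_eq[of p 4 k] by simp
      moreover have "k < n" using k pos prime_gt_1_nat[OF p(1)] by simp
      ultimately obtain p' where "prime p'" "p' dvd k" "p' mod 4 = 3"
        using less.IH by blast
      then show ?thesis using k by auto
    next
      case 4 then show ?thesis using p by blast
    next
      case 1
      then have "even p" by presburger
      then have "even n" using p by (meson dvd_trans)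
      then show ?thesis using less.prems by presburger
    next
      case 3
      then have "even p" by presburger
      then have "even n" using p by (meson dvd_trans)
      then show ?thesis using less.prems by presburger
    qed
  qed
  define n where "n = 4 * fact (nat B) - (1::nat)"
  have f: "fact (nat B) \<ge> (1::nat)" by simp
  then obtain k where "fact (nat B) = Suc k" by (cases "fact (nat B) :: nat") auto
  then have "n = 3 + k * 4" unfolding n_def by simp
  then have "n mod 4 = 3" by (simp only: mod_mult_self1) simp
  then obtain p where p: "prime p" "p dvd n" "p mod 4 = 3" using aux by blast
  have "\<not> p \<le> nat B"
  proof
    assume "p \<le> nat B"
    then have "p dvd 4 * fact (nat B)"
      using prime_ge_1_nat[OF p(1)] by (intro dvd_mult dvd_fact) auto
    moreover have "4 * fact (nat B) = n + 1" unfolding n_def using f by linarith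
    ultimately have "p dvd 1" using p(2) by (metis dvd_add_right_iff)
    then show False using p(1) by auto
  qed
  then have "int p > B" by linarith
  moreover have "int p mod 4 = 3" using p(3) by (metis of_nat_mod of_nat_numeral)
  ultimately show ?thesis using p(1) by (intro exI[of _ "int p"]) simp
qed

lemma mod_4_eq_3_odd:
  fixes n :: nat
  assumes "n mod 4 = 3"
  shows "odd n \<and> odd ((n - 1) div 2) \<and> n - 1 = 2 * ((n - 1) div 2)"
  using assms by presburger

text \<open>-1 is a non-residue: by Fermat, raising \<open>x\<^sup>2 \<equiv> - y\<^sup>2\<close> to
  the odd power \<open>(p - 1) / 2\<close> would give 1 \<equiv> -1.\<close>

lemma prime_3_mod_4_dvd_sum_squares:
  fixes p x y :: int
  assumes p: "prime p" "p mod 4 = 3" and d: "p dvd x\<^sup>2 + y\<^sup>2"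
  shows "p dvd x"
proof (rule ccontr)
  assume x: "\<not> p dvd x"
  then have y: "\<not> p dvd y"
    using d by (metis dvd_add_left_iff p(1) prime_dvd_power power2_eq_square dvd_mult2)
  have "p \<noteq> 2" using p(2) by auto
  then have pp: "nat p > 2" "prime (nat p)" "int (nat p) = p"
    using p(1) prime_gt_1_int[OF p(1)] by auto
  have m4: "nat p mod 4 = 3" using p(2) pp(1) by (simp add: nat_mod_distrib[symmetric] flip: nat_numeral)
  define k where "k = (nat p - 1) div 2"
  have k: "odd k" "nat p - 1 = 2 * k" 
    using m4 mod_4_eq_3_odd[of "nat p"] unfolding k_def by auto
  have fermat: "[z ^ (nat p - 1) = 1] (mod p)" if "\<not> p dvd z" for z
  proof -
    have z: "int (nat (z mod p)) = z mod p" using pp by simp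
    have "\<not> nat p dvd nat (z mod p)"
      using that z pp(3) by (metis dvd_mod_iff dvd_refl of_nat_dvd_iff)
    from fermat_theorem[OF pp(2) this]
    have "[(z mod p) ^ (nat p - 1) = 1] (mod p)"
      using z pp(3) by (metis cong_int_iff of_nat_1 of_nat_power)
    then show ?thesis by (simp add: cong_def power_mod)
  qed
  have "[x\<^sup>2 = - (y\<^sup>2)] (mod p)" using d by (simp add: cong_iff_dvd_diff)
  then have "[(x\<^sup>2) ^ k = (- (y\<^sup>2)) ^ k] (mod p)" by (rule cong_pow)
  then have "[x ^ (nat p - 1) = - (y ^ (nat p - 1))] (mod p)"
    using k by (simp add: power_mult)
  moreover have "[x ^ (nat p - 1) = 1] (mod p)" "[- (y ^ (nat p - 1)) = - 1] (mod p)"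
    using fermat x y cong_minus_minus_iff by blast+
  ultimately have "[1 = - 1] (mod p)" by (meson cong_sym cong_trans)
  then have "p dvd 2" by (simp add: cong_iff_dvd_diff)
  then show False using pp zdvd_imp_le[of p 2] by linarith
qed

text \<open>The unit group modulo \<open>p\<^sup>2\<close> has order \<open>2 * s\<close> with
  \<open>s\<close> odd. So \<open>n ^ s\<close> is 1 or -1, and the square
  \<open>n ^ (s + 1)\<close> is \<open>n\<close> or \<open>- n\<close>.\<close>

lemma square_or_neg_square:
  fixes p n :: int
  assumes p: "prime p" "p mod 4 = 3" and n: "\<not> p dvd n"
  shows "\<exists>r. [r\<^sup>2 = n] (mod p\<^sup>2) \<or> [r\<^sup>2 = - n] (mod p\<^sup>2)"
proof -
  have "p \<noteq> 2" using p(2) by auto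
  then have pp: "p > 2" "prime (nat p)" "int (nat p) = p"
    using p(1) prime_gt_1_int[OF p(1)] by auto
  have m4: "nat p mod 4 = 3" using p(2) pp(1) by (simp add: nat_mod_distrib[symmetric] flip: nat_numeral)
  define s where "s = nat p * ((nat p - 1) div 2)"
  have "odd (nat p)" "odd ((nat p - 1) div 2)" using m4 mod_4_eq_3_odd by auto
  then have "odd s" unfolding s_def by simp
  have tot: "totient ((nat p)\<^sup>2) = 2 * s"
    using totient_prime_power[OF pp(2), of 2] \<open>odd (nat p)\<close> unfolding s_def
    by (simp add: algebra_simps)
  define a where "a = nat (n mod p\<^sup>2)"
  have a: "int a = n mod p\<^sup>2" using pp by (simp add: a_def)
  have "\<not> p dvd int a" using n a by (simp add: dvd_mod_iff power2_eq_square)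
  then have "coprime a ((nat p)\<^sup>2)"
    using pp(2,3) by (metis coprime_commute coprime_power_right_iff int_dvd_int_iff prime_imp_coprime_nat)
  from euler_theorem[OF this] have "[int a ^ (2 * s) = 1] (mod p\<^sup>2)"
    using tot pp(3) by (metis cong_int_iff of_nat_1 of_nat_power)
  then have "[n ^ (2 * s) = 1] (mod p\<^sup>2)" unfolding a by (simp add: cong_def power_mod)
  moreover have "n ^ (2 * s) - 1 = (n ^ s - 1) * (n ^ s + 1)"
    by (simp add: algebra_simps power_mult power2_eq_square)
  ultimately have d: "p\<^sup>2 dvd (n ^ s - 1) * (n ^ s + 1)"
    by (simp add: cong_iff_dvd_diff)
  \<comment> \<open>The factors differ by 2, so \<open>p\<close> divides at most one of them, which
    then absorbs all of \<open>p\<^sup>2\<close>.\<close>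
  have "\<not> (p dvd n ^ s - 1 \<and> p dvd n ^ s + 1)"
  proof
    assume "p dvd n ^ s - 1 \<and> p dvd n ^ s + 1"
    then have "p dvd (n ^ s + 1) - (n ^ s - 1)" using dvd_diff by blast
    then show False using pp zdvd_imp_le[of p 2] by simp
  qed
  then have "coprime (p\<^sup>2) (n ^ s - 1) \<or> coprime (p\<^sup>2) (n ^ s + 1)"
    using p(1) by (metis coprime_power_left_iff prime_imp_coprime)
  then have "p\<^sup>2 dvd n ^ s + 1 \<or> p\<^sup>2 dvd n ^ s - 1"
    using d coprime_dvd_mult_right_iff coprime_dvd_mult_left_iff by blast
  then have "p\<^sup>2 dvd (n ^ s + 1) * n \<or> p\<^sup>2 dvd (n ^ s - 1) * n" by auto
  moreover have "(n ^ ((s + 1) div 2))\<^sup>2 = n ^ s * n"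
    using \<open>odd s\<close> by (metis Suc_eq_plus1 even_Suc dvd_mult_div_cancel mult.commute power_Suc power_mult)
  ultimately show ?thesis
    by (intro exI[of _ "n ^ ((s + 1) div 2)"]) (auto simp: cong_iff_dvd_diff algebra_simps)
qed

text \<open>With \<open>k\<close> the product of the primes dividing \<open>a\<close> but not
  \<open>b\<close>, every prime factor of \<open>a\<close> divides exactly one of \<open>b\<close>
  and \<open>k * m\<close>.\<close>

lemma exists_coprime_add_mult:
  fixes a b m :: int
  assumes "a \<noteq> 0" and prim: "\<And>r. prime r \<Longrightarrow> r dvd a \<Longrightarrow> r dvd b \<Longrightarrow> \<not> r dvd m"
  shows "\<exists>k. coprime a (b + k * m)"
proof -
  define k where "k = \<Prod>{r \<in> prime_factors a. \<not> r dvd b}"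
  have fin: "finite {r \<in> prime_factors a. \<not> r dvd b}" by simp
  have "coprime a (b + k * m)"
  proof (rule ccontr)
    assume "\<not> coprime a (b + k * m)"
    then obtain r where r: "prime r" "r dvd a" "r dvd b + k * m"
      using \<open>a \<noteq> 0\<close> prime_divisor_exists[of "gcd a (b + k * m)"] by auto
    show False
    proof (cases "r dvd b")
      case True
      then have "\<not> r dvd m" "r dvd k * m" using prim r by (auto simp: dvd_add_right_iff)
      then have "r dvd k" using r(1) prime_dvd_mult_iff by blast
      then obtain r' where r': "r' \<in> prime_factors a" "\<not> r' dvd b" "r dvd r'"
        using prime_dvd_prod_iff[OF fin r(1), of "\<lambda>x. x"] unfolding k_def by auto
      then have "r = r'" using r(1) by (metis in_prime_factors_iff primes_dvd_imp_eq)
      then show False using True r' by simp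
    next
      case False
      then have "r dvd k" unfolding k_def
        using r \<open>a \<noteq> 0\<close> fin by (intro dvd_prod_eqI[of _ r]) (auto simp: prime_factors_dvd)
      then show False using r(3) False by (simp add: dvd_add_left_iff)
    qed
  qed
  then show ?thesis by blast
qed

text \<open>If \<open>n\<close> is not a square, \<open>- n\<close> is a square
  \<open>s\<^sup>2\<close>. For the least non-square \<open>m\<close>, \<open>m - 1\<close> is a
  square \<open>u\<^sup>2\<close> and \<open>- m\<close> a square \<open>r\<^sup>2\<close>; then
  \<open>(u\<^sup>2 + 1) * (s / r)\<^sup>2 = - s\<^sup>2 = n\<close> modulo
  \<open>p\<^sup>2\<close>.\<close>

lemma sum_two_squares_mod_prime_square:
  fixes p n :: int
  assumes p: "prime p" "p mod 4 = 3" and n: "\<not> p dvd n"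
  shows "\<exists>x y. [x\<^sup>2 + y\<^sup>2 = n] (mod p\<^sup>2)"
proof (cases "\<exists>r. [r\<^sup>2 = n] (mod p\<^sup>2)")
  case True
  then obtain r where "[r\<^sup>2 + 0\<^sup>2 = n] (mod p\<^sup>2)" by auto
  then show ?thesis by blast
next
  case False
  then obtain s where s: "[s\<^sup>2 = - n] (mod p\<^sup>2)"
    using square_or_neg_square[OF p n] by blast
  define nonres where "nonres k \<longleftrightarrow> (\<forall>r. \<not> [r\<^sup>2 = int k] (mod p\<^sup>2))" for k
  define m where "m = (LEAST k. nonres k)"
  have p2: "p > 2" using p prime_gt_1_int[OF p(1)] by (cases "p = 2") auto
  \<comment> \<open>\<open>p\<close> cannot divide \<open>r\<^sup>2 + 1\<close>, so
    \<open>p - 1\<close> is a non-square. This bounds \<open>m\<close> below \<open>p\<close> and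
    makes it a unit.\<close>
  have nr: "nonres (nat (p - 1))"
    unfolding nonres_def
  proof (intro allI notI)
    fix r assume "[r\<^sup>2 = int (nat (p - 1))] (mod p\<^sup>2)"
    then have "p\<^sup>2 dvd r\<^sup>2 - (p - 1)" using p2 by (simp add: cong_iff_dvd_diff)
    then have "p dvd r\<^sup>2 - (p - 1)" by (metis dvd_mult_left power2_eq_square)
    then have "p dvd (r\<^sup>2 - (p - 1)) + p" by (rule dvd_add) simp
    then have "p dvd 1\<^sup>2 + r\<^sup>2" by (simp add: algebra_simps)
    from prime_3_mod_4_dvd_sum_squares[OF p this] show False using p2 zdvd_imp_le[of p 1] by simp
  qed
  then have m: "nonres m" unfolding m_def by (rule LeastI)
  have "m \<le> nat (p - 1)" unfolding m_def using nr by (rule Least_le)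
  moreover have "m > 0"
  proof (rule ccontr)
    assume "\<not> m > 0"
    then have "[0\<^sup>2 = int m] (mod p\<^sup>2)" by simp
    then show False using m nonres_def by blast
  qed
  ultimately have pm: "\<not> p dvd int m"
    using p2 zdvd_imp_le[of p "int m"] by fastforce
  then obtain r where r: "[r\<^sup>2 = - int m] (mod p\<^sup>2)"
    using square_or_neg_square[OF p] m nonres_def by blast
  have "\<not> nonres (m - 1)"
    using \<open>m > 0\<close> unfolding m_def by (intro not_less_Least) simp
  then obtain u where u: "[u\<^sup>2 = int m - 1] (mod p\<^sup>2)"
    using \<open>m > 0\<close> unfolding nonres_def by (auto simp: of_nat_diff)
  have "\<not> p dvd r"
  proof
    assume "p dvd r"
    then have "p dvd r\<^sup>2" by (simp add: power2_eq_square)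
    moreover have "p dvd r\<^sup>2 + int m"
      using r by (metis cong_iff_dvd_diff diff_minus_eq_add dvd_mult_left power2_eq_square)
    ultimately show False using pm by (simp add: dvd_add_right_iff)
  qed
  then have "coprime r (p\<^sup>2)"
    using p(1) by (metis coprime_commute coprime_power_right_iff prime_imp_coprime)
  then obtain r' where r': "[r * r' = 1] (mod p\<^sup>2)"
    using cong_solve_coprime_int by blast
  have "[(u * (s * r'))\<^sup>2 + (s * r')\<^sup>2 = (u\<^sup>2 + 1) * s\<^sup>2 * r'\<^sup>2] (mod p\<^sup>2)"
    by (simp add: algebra_simps)
  also have "[(u\<^sup>2 + 1) * s\<^sup>2 * r'\<^sup>2 = ((int m - 1) + 1) * (- n) * r'\<^sup>2] (mod p\<^sup>2)"
    by (intro cong_mult cong_add cong_refl u s)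
  also have "[((int m - 1) + 1) * (- n) * r'\<^sup>2 = n * (- int m) * r'\<^sup>2] (mod p\<^sup>2)"
    by (simp add: algebra_simps)
  also have "[n * (- int m) * r'\<^sup>2 = n * r\<^sup>2 * r'\<^sup>2] (mod p\<^sup>2)"
    by (intro cong_mult cong_refl cong_sym[OF r])
  also have "[n * r\<^sup>2 * r'\<^sup>2 = n * (r * r')\<^sup>2] (mod p\<^sup>2)"
    by (simp add: algebra_simps)
  also have "[n * (r * r')\<^sup>2 = n * 1\<^sup>2] (mod p\<^sup>2)"
    by (intro cong_mult cong_refl cong_pow r')
  finally show ?thesis by auto
qed

section \<open>Triangles modulo \<open>p\<^sup>2\<close> with prescribed norms\<close>

text \<open>If \<open>a\<close>, \<open>b\<close>, \<open>c\<close> are the determinants of the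
  point pairs (P1, P2), (P2, P3), (P3, P1), the expression is twice the signed area of the triangle
  P1, s P2, t P3. For \<open>s = 1\<close>, its values at \<open>t = 1\<close> and
  \<open>t = - 1\<close> add up to \<open>2 * a\<close>.\<close>

lemma exists_signs_not_dvd:
  fixes p a b c :: int
  assumes "prime p" "p \<noteq> 2" "\<not> p dvd a"
  shows "\<exists>s t. s\<^sup>2 = 1 \<and> t\<^sup>2 = 1 \<and> \<not> p dvd s * a + s * t * b + t * c"
proof (rule ccontr)
  assume "\<nexists>s t. s\<^sup>2 = 1 \<and> t\<^sup>2 = 1 \<and> \<not> p dvd s * a + s * t * b + t * c"
  then have *: "p dvd s * a + s * t * b + t * c" if "s\<^sup>2 = 1" "t\<^sup>2 = 1" for s t
    using that by blast
  have "p dvd (1 * a + 1 * 1 * b + 1 * c) + (1 * a + 1 * (-1) * b + (-1) * c)"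
    by (intro dvd_add *) auto
  then have "p dvd 2 * a" by simp
  then show False using assms
    by (metis prime_dvd_mult_iff primes_dvd_imp_eq two_is_prime)
qed

text \<open>Norms survive quarter turns, sign changes and reflections. A quarter turn makes the
  determinant of the first two points a unit, signs do the same for the triangle, and a reflection
  fixes the square class. The free factor \<open>r\<^sup>2\<close> is later matched by a sum of two
  squares.\<close>

lemma local_triangle:
  fixes p k n1 n2 n3 :: int
  assumes p: "prime p" "p mod 4 = 3"
    and n: "\<not> p dvd n1" "\<not> p dvd n2" "\<not> p dvd n3" and k: "\<not> p dvd k"
  obtains x1 y1 x2 y2 x3 y3 r where
    "[x1\<^sup>2 + y1\<^sup>2 = n1] (mod p\<^sup>2)" "[x2\<^sup>2 + y2\<^sup>2 = n2] (mod p\<^sup>2)" "[x3\<^sup>2 + y3\<^sup>2 = n3] (mod p\<^sup>2)"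
    "[(x2 - x1) * (y3 - y1) - (x3 - x1) * (y2 - y1) = k * r\<^sup>2] (mod p\<^sup>2)" "\<not> p dvd r"
proof -
  have unit: "\<not> p dvd v" if "[v = w] (mod p\<^sup>2)" "\<not> p dvd w" for v w
    using that by (metis cong_dvd_iff cong_dvd_modulus dvd_triv_left power2_eq_square)
  obtain x1 y1 where 1: "[x1\<^sup>2 + y1\<^sup>2 = n1] (mod p\<^sup>2)"
    using sum_two_squares_mod_prime_square[OF p n(1)] by blast
  obtain u v where uv: "[u\<^sup>2 + v\<^sup>2 = n2] (mod p\<^sup>2)"
    using sum_two_squares_mod_prime_square[OF p n(2)] by blast
  obtain x3 y3 where 3: "[x3\<^sup>2 + y3\<^sup>2 = n3] (mod p\<^sup>2)"
    using sum_two_squares_mod_prime_square[OF p n(3)] by blast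
  have "\<exists>x2 y2. [x2\<^sup>2 + y2\<^sup>2 = n2] (mod p\<^sup>2) \<and> \<not> p dvd x1 * y2 - x2 * y1"
  proof (cases "p dvd x1 * v - u * y1")
    case True
    \<comment> \<open>The quarter turn of \<open>(u, v)\<close> serves instead: by the product
      identity for sums of two squares, both determinants cannot vanish modulo
      \<open>p\<close>.\<close>
    have "\<not> p dvd x1 * u - (- v) * y1"
    proof
      assume "p dvd x1 * u - (- v) * y1"
      with True have "p dvd (x1 * v - u * y1)\<^sup>2 + (x1 * u - (- v) * y1)\<^sup>2"
        by (auto simp: power2_eq_square)
      also have "\<dots> = (x1\<^sup>2 + y1\<^sup>2) * (u\<^sup>2 + v\<^sup>2)" by Groebner_Basis.algebra
      finally have "p dvd (x1\<^sup>2 + y1\<^sup>2) * (u\<^sup>2 + v\<^sup>2)" .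
      then show False using unit[OF 1 n(1)] unit[OF uv n(2)] p(1) prime_dvd_mult_iff by blast
    qed
    moreover have "[(- v)\<^sup>2 + u\<^sup>2 = n2] (mod p\<^sup>2)" using uv by (simp add: add.commute)
    ultimately show ?thesis by blast
  qed (use uv in blast)
  then obtain x2 y2 where 2: "[x2\<^sup>2 + y2\<^sup>2 = n2] (mod p\<^sup>2)" "\<not> p dvd x1 * y2 - x2 * y1" by blast
  have "p \<noteq> 2" using p(2) by auto
  from exists_signs_not_dvd[OF p(1) this 2(2)]
  obtain s t where st: "s\<^sup>2 = 1" "t\<^sup>2 = 1"
    and d: "\<not> p dvd s * (x1 * y2 - x2 * y1) + s * t * (x2 * y3 - x3 * y2) + t * (x3 * y1 - x1 * y3)"
    by blast
  define D where "D = (s * x2 - x1) * (t * y3 - y1) - (t * x3 - x1) * (s * y2 - y1)"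
  have "D = s * (x1 * y2 - x2 * y1) + s * t * (x2 * y3 - x3 * y2) + t * (x3 * y1 - x1 * y3)"
    unfolding D_def by Groebner_Basis.algebra
  with d have D: "\<not> p dvd D" by simp
  have "coprime k (p\<^sup>2)"
    using p(1) k by (metis coprime_commute coprime_power_right_iff prime_imp_coprime)
  then obtain k' where k': "[k * k' = 1] (mod p\<^sup>2)"
    using cong_solve_coprime_int by blast
  have "\<not> p dvd k * k'"
    using unit[OF k'] p(1) by (metis not_prime_unit)
  then have Dk: "\<not> p dvd D * k'" using D p(1) prime_dvd_mult_iff by (metis dvd_mult)
  \<comment> \<open>A reflection changes the sign of the determinant, so its ratio to \<open>k\<close> may be taken to be a square.\<close>
  obtain r e where r: "[r\<^sup>2 = e * (D * k')] (mod p\<^sup>2)" and e: "e\<^sup>2 = 1"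
    using square_or_neg_square[OF p Dk]
    by (metis mult_1 mult_minus_left one_power2 power2_minus)
  have e': "e = 1 \<or> e = - 1" using e by (simp add: power2_eq_1_iff)
  have "\<not> p dvd e * (D * k')" using e' Dk by auto
  then have "\<not> p dvd r\<^sup>2" using unit[OF r] by blast
  then have pr: "\<not> p dvd r" by (auto simp: power2_eq_square)
  have "[k * r\<^sup>2 = k * (e * (D * k'))] (mod p\<^sup>2)" by (intro cong_mult cong_refl r)
  also have "[k * (e * (D * k')) = e * D * (k * k')] (mod p\<^sup>2)" by (simp add: algebra_simps)
  also have "[e * D * (k * k') = e * D * 1] (mod p\<^sup>2)" by (intro cong_mult cong_refl k')
  finally have kr: "[e * D = k * r\<^sup>2] (mod p\<^sup>2)" by (simp add: cong_sym)
  show ?thesis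
  proof (rule that[of x1 "e * y1" "s * x2" "e * (s * y2)" "t * x3" "e * (t * y3)" r])
    have "e * D = (s * x2 - x1) * (e * (t * y3) - e * y1) - (t * x3 - x1) * (e * (s * y2) - e * y1)"
      unfolding D_def by Groebner_Basis.algebra
    then show "[(s * x2 - x1) * (e * (t * y3) - e * y1) - (t * x3 - x1) * (e * (s * y2) - e * y1)
        = k * r\<^sup>2] (mod p\<^sup>2)" using kr by simp
  qed (use 1 2 3 e st pr in \<open>simp_all add: power_mult_distrib\<close>)
qed

section \<open>Integer matrices and vectors with prescribed residues\<close>

text \<open>Opposite rows modulo \<open>l\<close> are compatible with determinant \<open>l\<close>.
  A primitive first row with the required residues is found first, and the second row is then solved
  for.\<close>

lemma matrix_lift_det:
  fixes a b c d m l s t :: int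
  assumes m: "m > 0" "l > 0" "coprime m l"
    and det: "[a * d - b * c = l] (mod m)"
    and prim: "\<And>r. prime r \<Longrightarrow> r dvd l \<Longrightarrow> r dvd s \<Longrightarrow> \<not> r dvd t"
  obtains a' b' c' d' where
    "[a' = a] (mod m)" "[b' = b] (mod m)" "[c' = c] (mod m)" "[d' = d] (mod m)"
    "[a' = s] (mod l)" "[b' = t] (mod l)" "[c' = - a'] (mod l)" "[d' = - b'] (mod l)"
    "a' * d' - b' * c' = l"
proof -
  have nocommon: False if "prime r" "r dvd m" "r dvd l" for r
    using that m(3) by (metis coprime_common_divisor not_prime_unit)
  obtain u where u: "[u = a] (mod m)" "[u = s] (mod l)"
    using binary_chinese_remainder_int[OF m(3)] by blast
  \<comment> \<open>\<open>exists_coprime_add_mult\<close> needs a nonzero entry;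
    \<open>m * l\<close> has the same residues as 0.\<close>
  define a' where "a' = (if u = 0 then m * l else u)"
  have a': "[a' = a] (mod m)" "[a' = s] (mod l)" "a' \<noteq> 0"
    using u m by (auto simp: a'_def cong_def)
  obtain v where v: "[v = b] (mod m)" "[v = t] (mod l)"
    using binary_chinese_remainder_int[OF m(3)] by blast
  \<comment> \<open>A prime dividing \<open>m\<close> and the first row would divide the determinant
    \<open>l\<close>, against coprimality; a prime divisor of \<open>l\<close> is excluded by
    \<open>prim\<close>.\<close>
  have "\<exists>k. coprime a' (v + k * (m * l))"
  proof (rule exists_coprime_add_mult[OF a'(3)])
    fix r assume r: "prime r" "r dvd a'" "r dvd v"
    show "\<not> r dvd m * l"
    proof
      assume "r dvd m * l"
      then consider "r dvd m" | "r dvd l" using r(1) prime_dvd_mult_iff by blast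
      then show False
      proof cases
        case 1
        then have "r dvd a" "r dvd b"
          using r a'(1) v(1) by (meson cong_dvd_iff cong_dvd_modulus)+
        then have "r dvd a * d - b * c" by simp
        then have "r dvd l" using det 1 by (meson cong_dvd_iff cong_dvd_modulus)
        then show False using nocommon r(1) 1 by blast
      next
        case 2
        then have "r dvd s" "r dvd t"
          using r a'(2) v(2) by (meson cong_dvd_iff cong_dvd_modulus)+
        then show False using prim r(1) 2 by blast
      qed
    qed
  qed
  then obtain k where k: "coprime a' (v + k * (m * l))" by blast
  define b' where "b' = v + k * (m * l)"
  have b': "[b' = b] (mod m)" "[b' = t] (mod l)"
    using cong_add[OF v(1), of "k * (m * l)" 0] cong_add[OF v(2), of "k * (m * l)" 0]
    unfolding b'_def by (simp_all add: cong_0_iff)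
  obtain \<alpha> \<beta> where ab: "\<alpha> * a' + \<beta> * b' = 1"
    using k unfolding b'_def[symmetric] by (metis bezout_int coprime_iff_gcd_eq_1)
  obtain l' where l': "[l * l' = 1] (mod m)"
    using m(3) cong_solve_coprime_int by (metis coprime_commute)
  \<comment> \<open>The second row will be \<open>l\<close> times \<open>(g1, g2)\<close> minus the first row, where \<open>(g1, g2)\<close> completes the
    first row to a unimodular matrix.\<close>
  define f1 where "f1 = l' * (c + a)"
  define f2 where "f2 = l' * (d + b)"
  \<comment> \<open>The completions of the first row are
    \<open>(- \<beta>, \<alpha>) + \<kappa> (a', b')\<close>. Modulo \<open>m\<close> the pair
    \<open>(f1, f2)\<close> is one of them, and \<open>\<alpha> * a' + \<beta> * b' = 1\<close> lets
    its \<open>\<kappa>\<close> be read off.\<close>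
  define \<kappa> where "\<kappa> = \<alpha> * (f1 + \<beta>) + \<beta> * (f2 - \<alpha>)"
  define g1 where "g1 = - \<beta> + \<kappa> * a'"
  define g2 where "g2 = \<alpha> + \<kappa> * b'"
  have g: "a' * g2 - b' * g1 = 1" using ab unfolding g1_def g2_def by Groebner_Basis.algebra
  have "[a' * f2 - b' * f1 = a * f2 - b * f1] (mod m)"
    by (intro cong_diff cong_mult cong_refl a' b')
  also have "a * f2 - b * f1 = l' * (a * d - b * c)" unfolding f1_def f2_def by Groebner_Basis.algebra
  also have "[\<dots> = l' * l] (mod m)" by (intro cong_mult cong_refl det)
  also have "[l' * l = 1] (mod m)" using l' by (simp add: mult.commute)
  finally have w: "m dvd a' * f2 - b' * f1 - 1" by (simp add: cong_iff_dvd_diff)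
  have "g1 - f1 = \<beta> * (a' * f2 - b' * f1 - 1)" "g2 - f2 = - \<alpha> * (a' * f2 - b' * f1 - 1)"
    using ab unfolding g1_def g2_def \<kappa>_def by Groebner_Basis.algebra+
  then have gf: "[g1 = f1] (mod m)" "[g2 = f2] (mod m)"
    using w by (simp_all add: cong_iff_dvd_diff)
  have row: "[- a' + l * g1 = c] (mod m)" if "[g1 = l' * (c + a)] (mod m)" "[a' = a] (mod m)" for a' a c g1
  proof -
    have "[- a' + l * g1 = - a + l * (l' * (c + a))] (mod m)"
      using that by (intro cong_add cong_mult cong_refl) (auto simp: cong_minus_minus_iff)
    also have "- a + l * (l' * (c + a)) = - a + (l * l') * (c + a)" by simp
    also have "[\<dots> = - a + 1 * (c + a)] (mod m)" by (intro cong_add cong_mult cong_refl l')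
    finally show ?thesis by simp
  qed
  show ?thesis
  proof (rule that[of a' b' "- a' + l * g1" "- b' + l * g2"])
    show "[- a' + l * g1 = c] (mod m)" using row gf(1) a'(1) unfolding f1_def by blast
    show "[- b' + l * g2 = d] (mod m)" using row gf(2) b'(1) unfolding f2_def by blast
    have "a' * (- b' + l * g2) - b' * (- a' + l * g1) = l * (a' * g2 - b' * g1)" by Groebner_Basis.algebra
    then show "a' * (- b' + l * g2) - b' * (- a' + l * g1) = l" using g by simp
  qed (use a' b' in \<open>auto simp: cong_iff_dvd_diff\<close>)
qed

text \<open>Modulo \<open>l\<close>, \<open>z = u / v\<close> is a square root of -1, so
  \<open>s\<^sup>2 + t\<^sup>2 = (s + z * t) * (s - z * t)\<close>. The factors are given the values
  1 and \<open>n / 2\<close>; the value 1 excludes a common prime of \<open>s\<close>,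
  \<open>t\<close> and \<open>l\<close>.\<close>

lemma half_norm_residue:
  fixes u v l n :: int
  assumes l: "l = u\<^sup>2 + v\<^sup>2" "odd l" and uv: "coprime u v"
  obtains s t where "[2 * (s\<^sup>2 + t\<^sup>2) = n] (mod l)"
    "\<And>r. prime r \<Longrightarrow> r dvd l \<Longrightarrow> r dvd s \<Longrightarrow> \<not> r dvd t"
proof -
  have "coprime v (u\<^sup>2)" using uv by (simp add: coprime_commute)
  then have "coprime v l"
    using gcd_add_mult[of v v "u\<^sup>2"] unfolding l(1)
    by (simp add: coprime_iff_gcd_eq_1 power2_eq_square add.commute)
  then obtain v' where v': "[v * v' = 1] (mod l)" using cong_solve_coprime_int by blast
  define z where "z = u * v'"
  have "[z\<^sup>2 + 1\<^sup>2 = (u * v')\<^sup>2 + (v * v')\<^sup>2] (mod l)"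
    unfolding z_def by (intro cong_add cong_refl cong_pow cong_sym[OF v'])
  also have "(u * v')\<^sup>2 + (v * v')\<^sup>2 = l * v'\<^sup>2" unfolding l(1) by Groebner_Basis.algebra
  also have "[\<dots> = 0] (mod l)" by (simp add: cong_def)
  finally have z: "l dvd z\<^sup>2 + 1" by (simp add: cong_iff_dvd_diff)
  define i where "i = (l + 1) div 2"
  have i: "2 * i = l + 1" unfolding i_def using l(2) by presburger
  \<comment> \<open>\<open>i\<close> is 1/2 modulo \<open>l\<close>, so \<open>s\<close> and
    \<open>z * t\<close> are the half sum and half difference of 1 and \<open>n / 2\<close>.\<close>
  define s where "s = i * (1 + i * n)"
  define t where "t = - z * i * (1 - i * n)"
  show ?thesis
  proof (rule that[of s t])
    have "2 * (s\<^sup>2 + t\<^sup>2) - n = 2 * i\<^sup>2 * (1 - i * n)\<^sup>2 * (z\<^sup>2 + 1) + n * (4 * (2 * i - 1) * i\<^sup>2 + (4 * i\<^sup>2 - 1))"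
      unfolding s_def t_def by Groebner_Basis.algebra
    also have "\<dots> = 2 * i\<^sup>2 * (1 - i * n)\<^sup>2 * (z\<^sup>2 + 1) + n * (4 * i\<^sup>2 + 2 * i + 1) * l"
      using i by Groebner_Basis.algebra
    finally show "[2 * (s\<^sup>2 + t\<^sup>2) = n] (mod l)" using z by (simp add: cong_iff_dvd_diff)
    fix r assume r: "prime r" "r dvd l" "r dvd s"
    show "\<not> r dvd t"
    proof
      assume "r dvd t"
      have "r dvd z\<^sup>2 + 1" using z r by auto
      moreover have "s + z * t = 2 * i - i * (1 - i * n) * (z\<^sup>2 + 1)"
        unfolding s_def t_def by Groebner_Basis.algebra
      moreover have "r dvd s + z * t" using r \<open>r dvd t\<close> by simp
      ultimately have "r dvd (2 * i - i * (1 - i * n) * (z\<^sup>2 + 1)) + i * (1 - i * n) * (z\<^sup>2 + 1)"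
        by (metis dvd_add dvd_mult)
      then have "r dvd l + 1" using i by simp
      then have "r dvd 1" using r(2) by (simp add: dvd_add_right_iff)
      then show False using r(1) by (metis not_prime_unit)
    qed
  qed
qed

section \<open>Moving a triangle to new displacement vectors\<close>

text \<open>Cramer's rule gives the new point with denominator \<open>2 * \<Delta> * l\<close>. The
  congruences \<open>L\<close> compare the numerators with the old ones, which clears
  \<open>2 * \<Delta>\<close> and preserves residues modulo \<open>M\<close>; the midpoint
  conditions \<open>lin\<close> clear \<open>l\<close>.\<close>

lemma move_triangle:
  fixes x y m1 n1 m2 n2 M1 N1 M2 N2 h g l M \<Delta> :: int
  assumes P: "2 * (x * m1 + y * n1) + m1\<^sup>2 + n1\<^sup>2 = h" "2 * (x * m2 + y * n2) + m2\<^sup>2 + n2\<^sup>2 = g"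
    and \<Delta>: "\<Delta> = m1 * n2 - m2 * n1" "\<Delta> \<noteq> 0"
    and L: "[M1 = m1] (mod 2 * \<Delta> * M)" "[N1 = n1] (mod 2 * \<Delta> * M)"
      "[M2 = m2] (mod 2 * \<Delta> * M)" "[N2 = n2] (mod 2 * \<Delta> * M)"
    and l: "coprime l (2 * \<Delta>)" "[l = 1] (mod M)" "l \<noteq> 0"
    and D: "M1 * N2 - M2 * N1 = \<Delta> * l"
    and lin: "[M2 = - M1] (mod l)" "[N2 = - N1] (mod l)" "[2 * (M1\<^sup>2 + N1\<^sup>2) = h + g] (mod l)"
  obtains X Y where
    "2 * (X * M1 + Y * N1) + M1\<^sup>2 + N1\<^sup>2 = h" "2 * (X * M2 + Y * N2) + M2\<^sup>2 + N2\<^sup>2 = g"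
    "[X = x] (mod M)" "[Y = y] (mod M)"
proof -
  \<comment> \<open>A single Cramer numerator: the second coordinates of the vectors yield
    \<open>X\<close>, the first ones \<open>- Y\<close>.\<close>
  have solve: "\<exists>X. S2 * (h - (M1\<^sup>2 + N1\<^sup>2)) - S1 * (g - (M2\<^sup>2 + N2\<^sup>2)) = 2 * \<Delta> * l * X \<and> [X = z] (mod M)"
    if s: "[S1 = s1] (mod 2 * \<Delta> * M)" "[S2 = s2] (mod 2 * \<Delta> * M)" "[S2 = - S1] (mod l)"
      and z: "s2 * (h - (m1\<^sup>2 + n1\<^sup>2)) - s1 * (g - (m2\<^sup>2 + n2\<^sup>2)) = 2 * \<Delta> * z" for S1 S2 s1 s2 z
  proof -
    define T where "T = S2 * (h - (M1\<^sup>2 + N1\<^sup>2)) - S1 * (g - (M2\<^sup>2 + N2\<^sup>2))"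
    have "[T = s2 * (h - (m1\<^sup>2 + n1\<^sup>2)) - s1 * (g - (m2\<^sup>2 + n2\<^sup>2))] (mod 2 * \<Delta> * M)"
      unfolding T_def by (intro cong_diff cong_mult cong_add cong_pow cong_refl L s)
    then have "2 * \<Delta> * M dvd T - 2 * \<Delta> * z" unfolding z by (simp add: cong_iff_dvd_diff)
    then obtain k where k: "T - 2 * \<Delta> * z = 2 * \<Delta> * M * k" by blast
    then have Tk: "T = 2 * \<Delta> * (z + M * k)" by Groebner_Basis.algebra
    \<comment> \<open>Modulo \<open>l\<close> the opposite vectors have equal norms, and the
      numerator collapses to a multiple of
      \<open>2 * (M1\<^sup>2 + N1\<^sup>2) - (h + g)\<close>.\<close>
    have "[T = (- S1) * (h - (M1\<^sup>2 + N1\<^sup>2)) - S1 * (g - ((- M1)\<^sup>2 + (- N1)\<^sup>2))] (mod l)"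
      unfolding T_def by (intro cong_diff cong_mult cong_add cong_pow cong_refl s lin)
    also have "(- S1) * (h - (M1\<^sup>2 + N1\<^sup>2)) - S1 * (g - ((- M1)\<^sup>2 + (- N1)\<^sup>2))
        = S1 * (2 * (M1\<^sup>2 + N1\<^sup>2) - (h + g))" by Groebner_Basis.algebra
    also have "[\<dots> = S1 * ((h + g) - (h + g))] (mod l)"
      by (intro cong_mult cong_diff cong_refl lin)
    finally have "l dvd T" by (simp add: cong_iff_dvd_diff)
    then have "l dvd z + M * k" unfolding Tk using l(1) by (simp add: coprime_dvd_mult_right_iff)
    then obtain X where X: "z + M * k = l * X" by blast
    have "[1 * X = l * X] (mod M)" by (intro cong_mult cong_refl cong_sym[OF l(2)])
    also have "[l * X = z] (mod M)" using X by (simp add: cong_iff_dvd_diff flip: X)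
    finally have "[X = z] (mod M)" by simp
    moreover have "T = 2 * \<Delta> * l * X" using Tk X by simp
    ultimately show ?thesis unfolding T_def by blast
  qed
  have "n2 * (h - (m1\<^sup>2 + n1\<^sup>2)) - n1 * (g - (m2\<^sup>2 + n2\<^sup>2)) = 2 * \<Delta> * x"
    unfolding \<Delta>(1) P[symmetric] by Groebner_Basis.algebra
  from solve[OF L(2,4) lin(2) this] obtain X where
    X: "N2 * (h - (M1\<^sup>2 + N1\<^sup>2)) - N1 * (g - (M2\<^sup>2 + N2\<^sup>2)) = 2 * \<Delta> * l * X" "[X = x] (mod M)" by blast
  have "m2 * (h - (m1\<^sup>2 + n1\<^sup>2)) - m1 * (g - (m2\<^sup>2 + n2\<^sup>2)) = 2 * \<Delta> * (- y)"
    unfolding \<Delta>(1) P[symmetric] by Groebner_Basis.algebra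
  from solve[OF L(1,3) lin(1) this] obtain Y' where
    Y': "M2 * (h - (M1\<^sup>2 + N1\<^sup>2)) - M1 * (g - (M2\<^sup>2 + N2\<^sup>2)) = 2 * \<Delta> * l * Y'" "[Y' = - y] (mod M)" by blast
  define Y where "Y = - Y'"
  have Y: "M2 * (h - (M1\<^sup>2 + N1\<^sup>2)) - M1 * (g - (M2\<^sup>2 + N2\<^sup>2)) = - 2 * \<Delta> * l * Y" "[Y = y] (mod M)"
    using Y' cong_minus_minus_iff[of Y' "- y" M] unfolding Y_def by auto
  have nz: "\<Delta> * l \<noteq> 0" using \<Delta>(2) l(3) by simp
  have "\<Delta> * l * (2 * (X * M1 + Y * N1) + M1\<^sup>2 + N1\<^sup>2) = \<Delta> * l * h"
    using X(1) Y(1) D by Groebner_Basis.algebra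
  moreover have "\<Delta> * l * (2 * (X * M2 + Y * N2) + M2\<^sup>2 + N2\<^sup>2) = \<Delta> * l * g"
    using X(1) Y(1) D by Groebner_Basis.algebra
  ultimately show ?thesis using nz X(2) Y(2) that[of X Y] by simp
qed

lemma cramer_cong:
  fixes m1 n1 m2 n2 q \<mu> \<nu> :: int
  assumes "coprime (m1 * n2 - m2 * n1) q"
  obtains \<alpha> \<beta> where "[\<alpha> * m1 + \<beta> * m2 = \<mu>] (mod q)" "[\<alpha> * n1 + \<beta> * n2 = \<nu>] (mod q)"
proof -
  obtain i where i: "[(m1 * n2 - m2 * n1) * i = 1] (mod q)"
    using assms cong_solve_coprime_int by blast
  define \<alpha> where "\<alpha> = i * (\<mu> * n2 - \<nu> * m2)"
  define \<beta> where "\<beta> = i * (\<nu> * m1 - \<mu> * n1)"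
  have e: "\<alpha> * m1 + \<beta> * m2 = (m1 * n2 - m2 * n1) * i * \<mu>"
    "\<alpha> * n1 + \<beta> * n2 = (m1 * n2 - m2 * n1) * i * \<nu>"
    unfolding \<alpha>_def \<beta>_def by Groebner_Basis.algebra+
  show ?thesis
    by (rule that[of \<alpha> \<beta>]; unfold e)
      (use cong_mult[OF i cong_refl[of \<mu>]] cong_mult[OF i cong_refl[of \<nu>]] in simp_all)
qed

section \<open>Triangles of norms \<open>N\<close>, \<open>N + h\<close>, \<open>N + g\<close> and
  the sieve\<close>

text \<open>The equations express that \<open>(x + m1, y + n1)\<close> and
  \<open>(x + m2, y + n2)\<close> have squared norms \<open>N + h\<close> and \<open>N + g\<close>,
  in a form linear in \<open>x\<close> and \<open>y\<close> that suits Cramer's rule.\<close>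

definition triangle :: "int \<Rightarrow> int \<Rightarrow> int \<Rightarrow> bool" where
  "triangle h g N \<longleftrightarrow> (\<exists>x y m1 n1 m2 n2. N = x\<^sup>2 + y\<^sup>2 \<and>
     2 * (x * m1 + y * n1) + m1\<^sup>2 + n1\<^sup>2 = h \<and> 2 * (x * m2 + y * n2) + m2\<^sup>2 + n2\<^sup>2 = g \<and>
     m1 * n2 - m2 * n1 \<noteq> 0)"

lemma not_dvd_of_abs_less:
  fixes p d :: int
  assumes "\<bar>d\<bar> < p" "d \<noteq> 0"
  shows "\<not> p dvd d"
  using assms dvd_imp_le_int[of d p] by auto

text \<open>The linear system has determinant \<open>2 * (m1 * n2 - m2 * n1)\<close>, a unit modulo
  \<open>p\<^sup>2\<close>. So a moved triangle inherits the norm of the local one it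
  imitates.\<close>

lemma local_point_unique:
  fixes p x y X Y m1 n1 m2 n2 M1 N1 M2 N2 h g :: int
  assumes p: "prime p" "p \<noteq> 2" and D: "\<not> p dvd m1 * n2 - m2 * n1"
    and x: "[2 * (x * m1 + y * n1) + m1\<^sup>2 + n1\<^sup>2 = h] (mod p\<^sup>2)"
      "[2 * (x * m2 + y * n2) + m2\<^sup>2 + n2\<^sup>2 = g] (mod p\<^sup>2)"
    and M: "[M1 = m1] (mod p\<^sup>2)" "[N1 = n1] (mod p\<^sup>2)" "[M2 = m2] (mod p\<^sup>2)" "[N2 = n2] (mod p\<^sup>2)"
    and X: "2 * (X * M1 + Y * N1) + M1\<^sup>2 + N1\<^sup>2 = h" "2 * (X * M2 + Y * N2) + M2\<^sup>2 + N2\<^sup>2 = g"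
  shows "[X = x] (mod p\<^sup>2)" "[Y = y] (mod p\<^sup>2)"
proof -
  have "[2 * (X * M1 + Y * N1) + M1\<^sup>2 + N1\<^sup>2 = 2 * (X * m1 + Y * n1) + m1\<^sup>2 + n1\<^sup>2] (mod p\<^sup>2)"
    "[2 * (X * M2 + Y * N2) + M2\<^sup>2 + N2\<^sup>2 = 2 * (X * m2 + Y * n2) + m2\<^sup>2 + n2\<^sup>2] (mod p\<^sup>2)"
    by (intro cong_add cong_mult cong_pow cong_refl M)+
  then have "[2 * (X * m1 + Y * n1) + m1\<^sup>2 + n1\<^sup>2 = 2 * (x * m1 + y * n1) + m1\<^sup>2 + n1\<^sup>2] (mod p\<^sup>2)"
    "[2 * (X * m2 + Y * n2) + m2\<^sup>2 + n2\<^sup>2 = 2 * (x * m2 + y * n2) + m2\<^sup>2 + n2\<^sup>2] (mod p\<^sup>2)"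
    using X x by (metis cong_sym cong_trans)+
  then have E: "p\<^sup>2 dvd 2 * ((X - x) * m1 + (Y - y) * n1)" "p\<^sup>2 dvd 2 * ((X - x) * m2 + (Y - y) * n2)"
    by (simp_all add: cong_iff_dvd_diff algebra_simps)
  have "coprime (p\<^sup>2) 2"
    using p by (metis coprime_power_left_iff prime_imp_coprime primes_dvd_imp_eq two_is_prime)
  moreover have "coprime (p\<^sup>2) (m1 * n2 - m2 * n1)"
    using p(1) D by (metis coprime_power_left_iff prime_imp_coprime)
  ultimately have cop: "coprime (p\<^sup>2) (2 * (m1 * n2 - m2 * n1))"
    by (simp only: coprime_mult_right_iff)
  have "p\<^sup>2 dvd n2 * (2 * ((X - x) * m1 + (Y - y) * n1)) - n1 * (2 * ((X - x) * m2 + (Y - y) * n2))"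
    by (intro dvd_diff dvd_mult[OF E(1)] dvd_mult[OF E(2)])
  also have "\<dots> = 2 * (m1 * n2 - m2 * n1) * (X - x)" by Groebner_Basis.algebra
  finally show "[X = x] (mod p\<^sup>2)"
    using cop by (simp only: cong_iff_dvd_diff coprime_dvd_mult_right_iff)
  have "p\<^sup>2 dvd m1 * (2 * ((X - x) * m2 + (Y - y) * n2)) - m2 * (2 * ((X - x) * m1 + (Y - y) * n1))"
    by (intro dvd_diff dvd_mult[OF E(1)] dvd_mult[OF E(2)])
  also have "\<dots> = 2 * (m1 * n2 - m2 * n1) * (Y - y)" by Groebner_Basis.algebra
  finally show "[Y = y] (mod p\<^sup>2)"
    using cop by (simp only: cong_iff_dvd_diff coprime_dvd_mult_right_iff)
qed

lemma triangle_step: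
  fixes h g N M j B :: int
  assumes "triangle h g N" "M > 0" and j: "j \<noteq> 0" "j \<noteq> h" "j \<noteq> g"
  obtains p N' where "prime p" "p mod 4 = 3" "p > B" "triangle h g N'"
    "[N' = N] (mod M)" "[N' + j = p] (mod p\<^sup>2)"
proof -
  obtain x y m1 n1 m2 n2 where N: "N = x\<^sup>2 + y\<^sup>2"
    and P: "2 * (x * m1 + y * n1) + m1\<^sup>2 + n1\<^sup>2 = h" "2 * (x * m2 + y * n2) + m2\<^sup>2 + n2\<^sup>2 = g"
    and nz: "m1 * n2 - m2 * n1 \<noteq> 0"
    using assms(1) unfolding triangle_def by blast
  define \<Delta> where "\<Delta> = m1 * n2 - m2 * n1"
  define L where "L = 2 * \<Delta> * M"
  have L0: "L \<noteq> 0" "\<Delta> \<noteq> 0" using nz \<open>M > 0\<close> by (auto simp: L_def \<Delta>_def)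
  \<comment> \<open>The size of \<open>p\<close> makes \<open>L\<close>, \<open>j\<close>,
    \<open>j - h\<close> and \<open>j - g\<close> units modulo \<open>p\<close>, so that
    \<open>local_triangle\<close> applies to the norms \<open>p - j\<close>,
    \<open>p - j + h\<close>, \<open>p - j + g\<close>.\<close>
  obtain p where p: "prime p" "p mod 4 = 3"
    and big: "p > max (max B \<bar>L\<bar>) (max \<bar>j\<bar> (max \<bar>j - h\<bar> \<bar>j - g\<bar>))"
    using prime_3_mod_4_beyond by blast
  have p2: "p \<noteq> 2" using p(2) by auto
  have "\<not> p dvd L" using big L0 by (intro not_dvd_of_abs_less) auto
  then have pL: "coprime L (p\<^sup>2)"
    using p(1) by (metis coprime_commute coprime_power_right_iff prime_imp_coprime)
  have p\<Delta>: "\<not> p dvd \<Delta>" using \<open>\<not> p dvd L\<close> by (auto simp: L_def)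
  then have \<Delta>p: "coprime \<Delta> (p\<^sup>2)"
    using p(1) by (metis coprime_commute coprime_power_right_iff prime_imp_coprime)
  have nj: "\<not> p dvd p - j" "\<not> p dvd p - (j - h)" "\<not> p dvd p - (j - g)"
    using big j not_dvd_of_abs_less[of j p] not_dvd_of_abs_less[of "j - h" p] not_dvd_of_abs_less[of "j - g" p]
    by (auto simp: dvd_diff_right_iff)
  obtain x1 y1 x2 y2 x3 y3 r where
    loc: "[x1\<^sup>2 + y1\<^sup>2 = p - j] (mod p\<^sup>2)" "[x2\<^sup>2 + y2\<^sup>2 = p - (j - h)] (mod p\<^sup>2)"
      "[x3\<^sup>2 + y3\<^sup>2 = p - (j - g)] (mod p\<^sup>2)"
    and det: "[(x2 - x1) * (y3 - y1) - (x3 - x1) * (y2 - y1) = \<Delta> * r\<^sup>2] (mod p\<^sup>2)" and r: "\<not> p dvd r"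
    using local_triangle[OF p nj p\<Delta>] by metis
  define \<mu>1 where "\<mu>1 = x2 - x1"
  define \<nu>1 where "\<nu>1 = y2 - y1"
  define \<mu>2 where "\<mu>2 = x3 - x1"
  define \<nu>2 where "\<nu>2 = y3 - y1"
  note det = det[folded \<mu>1_def \<nu>1_def \<mu>2_def \<nu>2_def]
  have "2 * (x1 * \<mu>1 + y1 * \<nu>1) + \<mu>1\<^sup>2 + \<nu>1\<^sup>2 = (x2\<^sup>2 + y2\<^sup>2) - (x1\<^sup>2 + y1\<^sup>2)"
    "2 * (x1 * \<mu>2 + y1 * \<nu>2) + \<mu>2\<^sup>2 + \<nu>2\<^sup>2 = (x3\<^sup>2 + y3\<^sup>2) - (x1\<^sup>2 + y1\<^sup>2)"
    unfolding \<mu>1_def \<nu>1_def \<mu>2_def \<nu>2_def by Groebner_Basis.algebra+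
  then have locP: "[2 * (x1 * \<mu>1 + y1 * \<nu>1) + \<mu>1\<^sup>2 + \<nu>1\<^sup>2 = h] (mod p\<^sup>2)"
    "[2 * (x1 * \<mu>2 + y1 * \<nu>2) + \<mu>2\<^sup>2 + \<nu>2\<^sup>2 = g] (mod p\<^sup>2)"
    using cong_diff[OF loc(2) loc(1)] cong_diff[OF loc(3) loc(1)] by simp_all

  have rp: "coprime r (p\<^sup>2)"
    using p(1) r by (metis coprime_commute coprime_power_right_iff prime_imp_coprime)
  have "\<not> p dvd \<Delta> * r\<^sup>2" using p(1) p\<Delta> r by (simp add: prime_dvd_mult_iff prime_dvd_power_iff)
  then have locD: "\<not> p dvd \<mu>1 * \<nu>2 - \<mu>2 * \<nu>1"
    using det by (metis cong_dvd_iff cong_dvd_modulus dvd_triv_left power2_eq_square)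

  \<comment> \<open>As \<open>v\<close> vanishes modulo both moduli,
    \<open>l = u\<^sup>2 + v\<^sup>2\<close> is 1 modulo \<open>L\<close> and
    \<open>r\<^sup>2\<close> modulo \<open>p\<^sup>2\<close>.\<close>
  obtain u where u: "[u = 1] (mod L)" "[u = r] (mod p\<^sup>2)"
    using binary_chinese_remainder_int[OF pL] by blast
  define v where "v = L * p\<^sup>2"
  define l where "l = u\<^sup>2 + v\<^sup>2"
  have "coprime u L" "coprime u (p\<^sup>2)"
    using u rp cong_imp_coprime cong_sym by (metis coprime_1_left)+
  then have uv: "coprime u v" unfolding v_def by simp
  have "[l = 1\<^sup>2 + 0\<^sup>2] (mod L)" unfolding l_def
    by (intro cong_add cong_pow u) (simp add: v_def cong_0_iff)
  then have l1: "[l = 1] (mod L)" by simp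
  have "[l = r\<^sup>2 + 0\<^sup>2] (mod p\<^sup>2)" unfolding l_def
    by (intro cong_add cong_pow u) (simp add: v_def cong_0_iff)
  then have lr: "[l = r\<^sup>2] (mod p\<^sup>2)" by simp
  have "even L" by (simp add: L_def)
  then have "odd l" using l1 by (metis cong_dvd_iff cong_dvd_modulus odd_one)
  moreover have "l \<ge> 0" by (simp add: l_def)
  ultimately have l0: "l > 0" by (cases "l = 0") auto
  have lL: "coprime l L" using l1 cong_imp_coprime cong_sym by (metis coprime_1_left)
  have "coprime l (p\<^sup>2)" using lr rp cong_imp_coprime cong_sym by (metis coprime_power_left_iff zero_less_numeral)
  with lL have ml: "coprime (\<bar>L\<bar> * p\<^sup>2) l" by (simp add: coprime_commute)
  have m0: "\<bar>L\<bar> * p\<^sup>2 > 0" using L0 prime_gt_0_int[OF p(1)] by simp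
  have l\<Delta>: "coprime \<Delta> l" "coprime l (2 * \<Delta>)" using lL by (simp_all add: L_def coprime_commute)

  \<comment> \<open>\<open>(a, b)\<close> and \<open>(c, d)\<close> are the rows, modulo
    \<open>p\<^sup>2\<close>, of the matrix taking the old vectors to the local ones. Comparing
    areas shows that its determinant is \<open>r\<^sup>2\<close>, hence \<open>l\<close>.\<close>
  obtain a b where ab: "[a * m1 + b * m2 = \<mu>1] (mod p\<^sup>2)" "[a * n1 + b * n2 = \<nu>1] (mod p\<^sup>2)"
    using cramer_cong \<Delta>p unfolding \<Delta>_def by metis
  obtain c d where cd: "[c * m1 + d * m2 = \<mu>2] (mod p\<^sup>2)" "[c * n1 + d * n2 = \<nu>2] (mod p\<^sup>2)"
    using cramer_cong \<Delta>p unfolding \<Delta>_def by metis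
  have "(a * d - b * c) * \<Delta> = (a * m1 + b * m2) * (c * n1 + d * n2) - (c * m1 + d * m2) * (a * n1 + b * n2)"
    unfolding \<Delta>_def by Groebner_Basis.algebra
  also have "[\<dots> = \<mu>1 * \<nu>2 - \<mu>2 * \<nu>1] (mod p\<^sup>2)" by (intro cong_diff cong_mult ab cd)
  also note det
  finally have "[(a * d - b * c) * \<Delta> = r\<^sup>2 * \<Delta>] (mod p\<^sup>2)" by (simp add: mult.commute)
  then have abcd: "[a * d - b * c = l] (mod p\<^sup>2)"
    using \<Delta>p lr by (metis cong_mult_rcancel cong_sym cong_trans)

  obtain a0 b0 c0 d0 where
    a0: "[a0 = 1] (mod L)" "[a0 = a] (mod p\<^sup>2)" and b0: "[b0 = 0] (mod L)" "[b0 = b] (mod p\<^sup>2)" and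
    c0: "[c0 = 0] (mod L)" "[c0 = c] (mod p\<^sup>2)" and d0: "[d0 = 1] (mod L)" "[d0 = d] (mod p\<^sup>2)"
    using binary_chinese_remainder_int[OF pL] by metis
  have "[a0 * d0 - b0 * c0 = 1 * 1 - 0 * 0] (mod L)" by (intro cong_diff cong_mult a0 b0 c0 d0)
  then have "[a0 * d0 - b0 * c0 = l] (mod L)" using l1 by (metis cong_sym cong_trans diff_zero mult_1 mult_zero_left)
  moreover have "[a0 * d0 - b0 * c0 = a * d - b * c] (mod p\<^sup>2)" by (intro cong_diff cong_mult a0 b0 c0 d0)
  ultimately have "[a0 * d0 - b0 * c0 = l] (mod L * p\<^sup>2)"
    using abcd pL by (meson coprime_cong_mult cong_trans)
  \<comment> \<open>\<open>matrix_lift_det\<close> wants a positive modulus, while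
    \<open>\<Delta>\<close> may be negative.\<close>
  then have det0: "[a0 * d0 - b0 * c0 = l] (mod \<bar>L\<bar> * p\<^sup>2)"
    by (simp add: cong_iff_dvd_diff abs_if)

  \<comment> \<open>\<open>(s0, t0)\<close> is the target for the first vector modulo
    \<open>l\<close>, and \<open>(s, t)\<close> the first matrix row reaching it; a common prime of
    \<open>s\<close>, \<open>t\<close> and \<open>l\<close> would pass to \<open>s0\<close> and
    \<open>t0\<close>.\<close>
  obtain s0 t0 where st0: "[2 * (s0\<^sup>2 + t0\<^sup>2) = h + g] (mod l)"
    and prim0: "\<And>r. prime r \<Longrightarrow> r dvd l \<Longrightarrow> r dvd s0 \<Longrightarrow> \<not> r dvd t0"
    using half_norm_residue[OF l_def \<open>odd l\<close> uv] by metis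
  obtain s t where st: "[s * m1 + t * m2 = s0] (mod l)" "[s * n1 + t * n2 = t0] (mod l)"
    using cramer_cong l\<Delta>(1) unfolding \<Delta>_def by metis
  have prim: "\<not> r dvd t" if "prime r" "r dvd l" "r dvd s" for r
  proof
    assume "r dvd t"
    then have "r dvd s * m1 + t * m2" "r dvd s * n1 + t * n2" using that by simp_all
    then have "r dvd s0" "r dvd t0" using st that(2) by (meson cong_dvd_iff cong_dvd_modulus)+
    then show False using prim0 that by blast
  qed
  obtain a' b' c' d' where
    W0: "[a' = a0] (mod \<bar>L\<bar> * p\<^sup>2)" "[b' = b0] (mod \<bar>L\<bar> * p\<^sup>2)" "[c' = c0] (mod \<bar>L\<bar> * p\<^sup>2)" "[d' = d0] (mod \<bar>L\<bar> * p\<^sup>2)"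
    and Wl: "[a' = s] (mod l)" "[b' = t] (mod l)" "[c' = - a'] (mod l)" "[d' = - b'] (mod l)"
    and W: "a' * d' - b' * c' = l"
    by (rule matrix_lift_det[OF m0 l0 ml det0, of s t]) (use prim in blast)+
  have dv: "L dvd \<bar>L\<bar> * p\<^sup>2" "p\<^sup>2 dvd \<bar>L\<bar> * p\<^sup>2" by simp_all
  have WL: "[a' = 1] (mod L)" "[b' = 0] (mod L)" "[c' = 0] (mod L)" "[d' = 1] (mod L)"
    using W0 a0(1) b0(1) c0(1) d0(1) dv(1) by (meson cong_dvd_modulus cong_trans)+
  have Wp: "[a' = a] (mod p\<^sup>2)" "[b' = b] (mod p\<^sup>2)" "[c' = c] (mod p\<^sup>2)" "[d' = d] (mod p\<^sup>2)"
    using W0 a0(2) b0(2) c0(2) d0(2) dv(2) by (meson cong_dvd_modulus cong_trans)+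

  define M1 where "M1 = a' * m1 + b' * m2"
  define N1 where "N1 = a' * n1 + b' * n2"
  define M2 where "M2 = c' * m1 + d' * m2"
  define N2 where "N2 = c' * n1 + d' * n2"
  have "[M1 = 1 * m1 + 0 * m2] (mod L)" "[N1 = 1 * n1 + 0 * n2] (mod L)"
    "[M2 = 0 * m1 + 1 * m2] (mod L)" "[N2 = 0 * n1 + 1 * n2] (mod L)"
    unfolding M1_def N1_def M2_def N2_def by (intro cong_add cong_mult cong_refl WL)+
  then have DL: "[M1 = m1] (mod 2 * \<Delta> * M)" "[N1 = n1] (mod 2 * \<Delta> * M)"
    "[M2 = m2] (mod 2 * \<Delta> * M)" "[N2 = n2] (mod 2 * \<Delta> * M)"
    unfolding L_def by simp_all
  have "[M1 = a * m1 + b * m2] (mod p\<^sup>2)" "[N1 = a * n1 + b * n2] (mod p\<^sup>2)"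
    "[M2 = c * m1 + d * m2] (mod p\<^sup>2)" "[N2 = c * n1 + d * n2] (mod p\<^sup>2)"
    unfolding M1_def N1_def M2_def N2_def by (intro cong_add cong_mult cong_refl Wp)+
  then have Dp: "[M1 = \<mu>1] (mod p\<^sup>2)" "[N1 = \<nu>1] (mod p\<^sup>2)" "[M2 = \<mu>2] (mod p\<^sup>2)" "[N2 = \<nu>2] (mod p\<^sup>2)"
    using ab cd by (meson cong_trans)+
  have "[M1 = s * m1 + t * m2] (mod l)" "[N1 = s * n1 + t * n2] (mod l)"
    unfolding M1_def N1_def by (intro cong_add cong_mult cong_refl Wl)+
  then have "[M1 = s0] (mod l)" "[N1 = t0] (mod l)" using st by (meson cong_trans)+
  then have "[2 * (M1\<^sup>2 + N1\<^sup>2) = 2 * (s0\<^sup>2 + t0\<^sup>2)] (mod l)"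
    by (intro cong_add cong_mult cong_pow cong_refl)
  then have norm_l: "[2 * (M1\<^sup>2 + N1\<^sup>2) = h + g] (mod l)" using st0 by (rule cong_trans)
  have "[M2 = (- a') * m1 + (- b') * m2] (mod l)" "[N2 = (- a') * n1 + (- b') * n2] (mod l)"
    unfolding M2_def N2_def by (intro cong_add cong_mult cong_refl Wl)+
  then have opp: "[M2 = - M1] (mod l)" "[N2 = - N1] (mod l)" unfolding M1_def N1_def by simp_all
  have "M1 * N2 - M2 * N1 = (a' * d' - b' * c') * \<Delta>"
    unfolding M1_def N1_def M2_def N2_def \<Delta>_def by Groebner_Basis.algebra
  then have D: "M1 * N2 - M2 * N1 = \<Delta> * l" using W by simp
  have "[l = 1] (mod M)" using l1 by (rule cong_dvd_modulus) (simp add: L_def)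
  then obtain X Y where
    X: "2 * (X * M1 + Y * N1) + M1\<^sup>2 + N1\<^sup>2 = h" "2 * (X * M2 + Y * N2) + M2\<^sup>2 + N2\<^sup>2 = g"
    and XM: "[X = x] (mod M)" "[Y = y] (mod M)"
    using move_triangle[OF P \<Delta>_def L0(2) DL l\<Delta>(2) _ _ D opp norm_l] l0 by auto
  show ?thesis
  proof (rule that[of p "X\<^sup>2 + Y\<^sup>2"])
    have "M1 * N2 - M2 * N1 \<noteq> 0" using D L0 l0 by simp
    then show "triangle h g (X\<^sup>2 + Y\<^sup>2)" unfolding triangle_def using X by blast
    show "[X\<^sup>2 + Y\<^sup>2 = N] (mod M)" unfolding N by (intro cong_add cong_pow XM)
    have "[X\<^sup>2 + Y\<^sup>2 = x1\<^sup>2 + y1\<^sup>2] (mod p\<^sup>2)"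
      by (intro cong_add cong_pow local_point_unique[OF p(1) p2 locD locP Dp X])
    then have "[X\<^sup>2 + Y\<^sup>2 = p - j] (mod p\<^sup>2)" using loc(1) by (rule cong_trans)
    from cong_add[OF this cong_refl[of j]] show "[X\<^sup>2 + Y\<^sup>2 + j = p] (mod p\<^sup>2)" by simp
  qed (use p big in auto)
qed

text \<open>After \<open>j\<close> is handled with a prime \<open>p\<close>, the modulus grows to
  \<open>M * p\<^sup>2\<close>, so that later moves keep \<open>N + j\<close> fixed modulo
  \<open>p\<^sup>2\<close>. Hence the induction generalises over \<open>N\<close> and
  \<open>M\<close>.\<close>

lemma triangle_sieve:
  fixes h g N M B :: int
  assumes "finite J" "triangle h g N" "M > 0" "0 \<notin> J" "h \<notin> J" "g \<notin> J"
  shows "\<exists>N'. triangle h g N' \<and> [N' = N] (mod M) \<and>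
    (\<forall>j\<in>J. \<exists>p. prime p \<and> p mod 4 = 3 \<and> p > B \<and> [N' + j = p] (mod p\<^sup>2))"
  using assms
proof (induction J arbitrary: N M rule: finite_induct)
  case empty
  then show ?case by (intro exI[of _ N]) simp
next
  case (insert j J)
  then obtain p N1 where p: "prime p" "p mod 4 = 3" "p > B" and N1: "triangle h g N1"
    "[N1 = N] (mod M)" "[N1 + j = p] (mod p\<^sup>2)"
    using triangle_step[of h g N M j B] by (metis insert_iff)
  have "M * p\<^sup>2 > 0" using insert.prems(2) prime_gt_0_int[OF p(1)] by simp
  from insert.IH[OF N1(1) this]
  obtain N' where N': "triangle h g N'" "[N' = N1] (mod M * p\<^sup>2)"
    "\<forall>j\<in>J. \<exists>p. prime p \<and> p mod 4 = 3 \<and> p > B \<and> [N' + j = p] (mod p\<^sup>2)"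
    using insert.prems by blast
  have "[N' = N1] (mod M)" "[N' = N1] (mod p\<^sup>2)"
    using N'(2) by (auto intro: cong_dvd_modulus)
  then have "[N' = N] (mod M)" "[N' + j = p] (mod p\<^sup>2)"
    using N1 by (meson cong_add cong_refl cong_trans)+
  then show ?case using N' p by blast
qed

section \<open>Consecutive sums of two squares with prescribed residues\<close>

text \<open>If \<open>p\<close> divides a sum of two squares it divides both terms' bases, so
  \<open>p\<^sup>2\<close> divides the sum; but \<open>p\<close> divides \<open>n\<close> exactly
  once.\<close>

lemma not_sum_two_squares:
  fixes p n x y :: int
  assumes p: "prime p" "p mod 4 = 3" and n: "[n = p] (mod p\<^sup>2)"
  shows "n \<noteq> x\<^sup>2 + y\<^sup>2"
proof
  assume eq: "n = x\<^sup>2 + y\<^sup>2"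
  have "p dvd n" using n by (metis cong_dvd_iff cong_dvd_modulus dvd_refl dvd_triv_left power2_eq_square)
  then have "p dvd x" "p dvd y"
    using prime_3_mod_4_dvd_sum_squares[OF p] eq by (metis add.commute)+
  then have "p\<^sup>2 dvd n" unfolding eq by (intro dvd_add) (auto simp: dvd_power_same)
  then have "p\<^sup>2 dvd p" using n cong_dvd_iff by blast
  then have "p * p dvd p * 1" by (simp add: power2_eq_square)
  then show False using p(1) by (metis dvd_mult_cancel_left not_prime_0 not_prime_unit)
qed

lemma mem_sums_two_squares_iff: "n \<in> sums_two_squares \<longleftrightarrow> (\<exists>x y::int. int n = x\<^sup>2 + y\<^sup>2)"
proof
  assume "n \<in> sums_two_squares"
  then obtain m l where "n = m\<^sup>2 + l\<^sup>2" unfolding sums_two_squares_def by blast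
  then have "int n = (int m)\<^sup>2 + (int l)\<^sup>2" by simp
  then show "\<exists>x y::int. int n = x\<^sup>2 + y\<^sup>2" by blast
next
  assume "\<exists>x y::int. int n = x\<^sup>2 + y\<^sup>2"
  then obtain x y :: int where "int n = x\<^sup>2 + y\<^sup>2" by blast
  then have "int n = int ((nat \<bar>x\<bar>)\<^sup>2 + (nat \<bar>y\<bar>)\<^sup>2)" by simp
  then have "n = (nat \<bar>x\<bar>)\<^sup>2 + (nat \<bar>y\<bar>)\<^sup>2" by (simp only: of_nat_eq_iff)
  then show "n \<in> sums_two_squares" unfolding sums_two_squares_def by blast
qed

lemma E_seq_next:
  assumes "k \<ge> 1" "E_seq k < n" "n \<in> sums_two_squares"
    "\<And>i. E_seq k < i \<Longrightarrow> i < n \<Longrightarrow> i \<notin> sums_two_squares"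
  shows "E_seq (k + 1) = n"
proof -
  obtain k' where k': "k' \<ge> 1" "n = E_seq k'" using assms(3) E_seq_image by auto
  have lt: "E_seq k < E_seq (k + 1)" using assms(1) by (intro E_seq_strict_mono) auto
  have "k < k'"
    using assms(2) k' E_seq_strict_mono[of k' k] by (metis less_asym' linorder_neqE_nat order_less_irrefl)
  moreover have "\<not> k + 1 < k'"
  proof
    assume "k + 1 < k'"
    then have "E_seq (k + 1) < n" unfolding k'(2) by (intro E_seq_strict_mono) auto
    moreover have "E_seq (k + 1) \<in> sums_two_squares" using E_seq_image by auto
    ultimately show False using assms(4) lt by blast
  qed
  ultimately show ?thesis using k' by (metis Suc_eq_plus1 Suc_lessI)
qed

text \<open>Coordinates of points representing the classes may be shifted by multiples of
  \<open>q\<close>; large shifts put the norms in order and make the triangle nondegenerate. The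
  three sums need not be consecutive yet.\<close>

lemma exists_triangle_residues:
  assumes q: "q \<ge> 1" and "admissible q a" "admissible q b" "admissible q c"
  obtains h g N where "0 < h" "h < g" "triangle h g N"
    "[N = a] (mod int q)" "[N + h = b] (mod int q)" "[N + g = c] (mod int q)"
proof -
  obtain xa ya xb yb xc yc :: int where r:
    "[xa\<^sup>2 + ya\<^sup>2 = a] (mod int q)" "[xb\<^sup>2 + yb\<^sup>2 = b] (mod int q)" "[xc\<^sup>2 + yc\<^sup>2 = c] (mod int q)"
    using assms unfolding admissible_def by metis
  have big: "\<exists>u'. [u' = u] (mod int q) \<and> u' > B" for u B :: int
  proof (intro exI conjI)
    show "[u + int q * (\<bar>B\<bar> + \<bar>u\<bar> + 1) = u] (mod int q)" by (simp add: cong_iff_dvd_diff)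
    have "1 * (\<bar>B\<bar> + \<bar>u\<bar> + 1) \<le> int q * (\<bar>B\<bar> + \<bar>u\<bar> + 1)"
      using q by (intro mult_right_mono) auto
    then have "\<bar>B\<bar> + \<bar>u\<bar> + 1 \<le> int q * (\<bar>B\<bar> + \<bar>u\<bar> + 1)" by (simp only: mult_1)
    moreover have "B < u + (\<bar>B\<bar> + \<bar>u\<bar> + 1)" by linarith
    ultimately show "u + int q * (\<bar>B\<bar> + \<bar>u\<bar> + 1) > B" by (meson add_left_mono order_less_le_trans)
  qed
  have sq: "t \<le> t\<^sup>2" for t :: int using self_le_power[of t 2] by (cases "t \<le> 0") (auto intro: order_trans)
  \<comment> \<open>\<open>x\<close> makes \<open>h\<close> positive and
    \<open>x - xa \<ge> 1\<close>; \<open>y\<close> makes \<open>g > h\<close> and lets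
    \<open>(x - xa) * (y - ya)\<close> dominate the determinant.\<close>
  obtain x where x: "[x = xb] (mod int q)" "x > \<bar>xa\<bar> + (xa\<^sup>2 + ya\<^sup>2)" using big by blast
  obtain y where y: "[y = yc] (mod int q)"
    "y > (x\<^sup>2 + yb\<^sup>2) + \<bar>ya\<bar> + \<bar>(xc - xa) * (yb - ya)\<bar>" using big by blast
  define h where "h = (x\<^sup>2 + yb\<^sup>2) - (xa\<^sup>2 + ya\<^sup>2)"
  define g where "g = (xc\<^sup>2 + y\<^sup>2) - (xa\<^sup>2 + ya\<^sup>2)"
  have pos: "0 \<le> xa\<^sup>2" "0 \<le> ya\<^sup>2" "0 \<le> yb\<^sup>2" "0 \<le> xc\<^sup>2" "0 \<le> x\<^sup>2" by simp_all
  have nz: "(x - xa) * (y - ya) - (xc - xa) * (yb - ya) \<noteq> 0"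
  proof -
    have "x - xa \<ge> 1" "y - ya \<ge> 0" using x(2) y(2) pos by linarith+
    then have "1 * (y - ya) \<le> (x - xa) * (y - ya)" by (intro mult_right_mono) auto
    moreover have "\<bar>(xc - xa) * (yb - ya)\<bar> < y - ya" using y(2) pos by linarith
    ultimately show ?thesis by simp
  qed
  show ?thesis
  proof (rule that[of h g "xa\<^sup>2 + ya\<^sup>2"])
    show "0 < h" unfolding h_def using x(2) sq[of x] pos by linarith
    show "h < g" unfolding h_def g_def using y(2) sq[of y] pos by linarith
    have "2 * (xa * (x - xa) + ya * (yb - ya)) + (x - xa)\<^sup>2 + (yb - ya)\<^sup>2 = h"
      "2 * (xa * (xc - xa) + ya * (y - ya)) + (xc - xa)\<^sup>2 + (y - ya)\<^sup>2 = g"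
      unfolding h_def g_def by Groebner_Basis.algebra+
    then show "triangle h g (xa\<^sup>2 + ya\<^sup>2)" unfolding triangle_def using nz by blast
    show "[xa\<^sup>2 + ya\<^sup>2 = a] (mod int q)" by fact
    have "[x\<^sup>2 + yb\<^sup>2 = xb\<^sup>2 + yb\<^sup>2] (mod int q)" by (intro cong_add cong_pow cong_refl x)
    then show "[xa\<^sup>2 + ya\<^sup>2 + h = b] (mod int q)" using r(2) unfolding h_def by (auto intro: cong_trans)
    have "[xc\<^sup>2 + y\<^sup>2 = xc\<^sup>2 + yc\<^sup>2] (mod int q)" by (intro cong_add cong_pow cong_refl y)
    then show "[xa\<^sup>2 + ya\<^sup>2 + g = c] (mod int q)" using r(3) unfolding g_def by (auto intro: cong_trans)
  qed
qed

lemma triangle_sums: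
  assumes "triangle h g N"
  shows "\<exists>x y. N = x\<^sup>2 + y\<^sup>2" "\<exists>x y. N + h = x\<^sup>2 + y\<^sup>2" "\<exists>x y. N + g = x\<^sup>2 + y\<^sup>2"
proof -
  obtain x y m1 n1 m2 n2 where N: "N = x\<^sup>2 + y\<^sup>2"
    and P: "2 * (x * m1 + y * n1) + m1\<^sup>2 + n1\<^sup>2 = h" "2 * (x * m2 + y * n2) + m2\<^sup>2 + n2\<^sup>2 = g"
    using assms unfolding triangle_def by blast
  have "N + h = (x + m1)\<^sup>2 + (y + n1)\<^sup>2" "N + g = (x + m2)\<^sup>2 + (y + n2)\<^sup>2"
    unfolding N P[symmetric] by Groebner_Basis.algebra+
  then show "\<exists>x y. N = x\<^sup>2 + y\<^sup>2" "\<exists>x y. N + h = x\<^sup>2 + y\<^sup>2" "\<exists>x y. N + g = x\<^sup>2 + y\<^sup>2"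
    using N by blast+
qed

lemma consecutive_pattern_beyond:
  fixes B :: nat
  assumes "q \<ge> 1" "admissible q a" "admissible q b" "admissible q c"
  shows "\<exists>k\<ge>1. E_seq k > B \<and> [int (E_seq k) = a] (mod int q) \<and>
    [int (E_seq (k + 1)) = b] (mod int q) \<and> [int (E_seq (k + 2)) = c] (mod int q)"
proof -
  obtain h g N0 where hg: "0 < h" "h < g" "triangle h g N0"
    "[N0 = a] (mod int q)" "[N0 + h = b] (mod int q)" "[N0 + g = c] (mod int q)"
    using exists_triangle_residues[OF assms] by metis
  \<comment> \<open>The index \<open>g + 1\<close> is only there to make \<open>N\<close> large.\<close>
  define J where "J = {1..<g} - {h} \<union> {g + 1}"
  have "finite J" "0 \<notin> J" "h \<notin> J" "g \<notin> J" using hg by (auto simp: J_def)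
  then obtain N where N: "triangle h g N" "[N = N0] (mod int q)" and
    J: "\<And>j. j \<in> J \<Longrightarrow> \<exists>p. prime p \<and> p mod 4 = 3 \<and> p > int B + g + 1 \<and> [N + j = p] (mod p\<^sup>2)"
    using triangle_sieve[of J h g N0 "int q" "int B + g + 1"] hg(3) assms(1) by auto
  note sums = triangle_sums[OF N(1)]
  have N0: "N \<ge> 0" using sums(1) by auto
  \<comment> \<open>This prime divides the positive number \<open>N + g + 1\<close>, which is thus
    larger than \<open>B + g + 1\<close>.\<close>
  obtain p where p: "prime p" "p > int B + g + 1" "[N + (g + 1) = p] (mod p\<^sup>2)"
    using J[of "g + 1"] by (auto simp: J_def)
  have "p dvd p\<^sup>2" by (simp add: power2_eq_square)
  then have "p dvd N + (g + 1)" using p(3) by (meson cong_dvd_iff cong_dvd_modulus dvd_refl)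
  then have "p \<le> N + (g + 1)" using N0 hg by (intro zdvd_imp_le) auto
  then have NB: "N > int B" using p(2) by linarith
  have res: "[N = a] (mod int q)" "[N + h = b] (mod int q)" "[N + g = c] (mod int q)"
    using N(2) hg(4-6) by (meson cong_add cong_refl cong_trans)+
  have gap: "i \<notin> sums_two_squares" if "N < int i" "int i < N + g" "int i \<noteq> N + h" for i
  proof -
    have "int i - N \<in> J" using that by (auto simp: J_def)
    then obtain p where "prime p" "p mod 4 = 3" "[int i = p] (mod p\<^sup>2)"
      using J[of "int i - N"] by auto
    then show ?thesis using not_sum_two_squares mem_sums_two_squares_iff by blast
  qed
  define n where "n = nat N"
  define n1 where "n1 = nat (N + h)"
  define n2 where "n2 = nat (N + g)"
  have n: "int n = N" "int n1 = N + h" "int n2 = N + g"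
    using N0 hg unfolding n_def n1_def n2_def by auto
  have mem: "n \<in> sums_two_squares" "n1 \<in> sums_two_squares" "n2 \<in> sums_two_squares"
    unfolding mem_sums_two_squares_iff n by (rule sums)+
  obtain k where k: "k \<ge> 1" "E_seq k = n" using mem(1) E_seq_image by (metis atLeast_iff imageE)
  have k1: "E_seq (k + 1) = n1"
  proof (rule E_seq_next[OF k(1)])
    show "i \<notin> sums_two_squares" if "E_seq k < i" "i < n1" for i
      using that k n hg by (intro gap) auto
  qed (use k n hg mem in auto)
  have "E_seq (k + 1 + 1) = n2"
  proof (rule E_seq_next)
    show "i \<notin> sums_two_squares" if "E_seq (k + 1) < i" "i < n2" for i
      using that k1 n hg by (intro gap) auto
  qed (use k1 n hg mem in auto)
  then have k2: "E_seq (k + 2) = n2" by simp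
  show ?thesis
    using k k1 k2 n res NB by (intro exI[of _ k]) auto
qed

theorem theorem1p2:
  fixes q :: nat and a b c :: int
  assumes "q \<ge> 1"
    and "admissible q a" and "admissible q b" and "admissible q c"
  shows "filterlim (\<lambda>x::real. N_count x q [a, b, c]) at_top at_top \<and>
         infinite {n. 1 \<le> n \<and> [int (E_seq n) = a] (mod int q) \<and>
           [int (E_seq (n + 1)) = b] (mod int q) \<and> [int (E_seq (n + 2)) = c] (mod int q)}"
proof -
  define A where "A = {n. 1 \<le> n \<and> [int (E_seq n) = a] (mod int q) \<and>
           [int (E_seq (n + 1)) = b] (mod int q) \<and> [int (E_seq (n + 2)) = c] (mod int q)}"
  have "infinite A"
  proof
    assume fin: "finite A"
    \<comment> \<open>The pattern occurs beyond every bound, so the values of \<open>E_seq\<close>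
      on \<open>A\<close> have no maximum.\<close>
    obtain k where "k \<in> A" "E_seq k > Max (E_seq ` A)"
      using consecutive_pattern_beyond[OF assms, of "Max (E_seq ` A)"] unfolding A_def by auto
    moreover have "E_seq k \<le> Max (E_seq ` A)" using fin \<open>k \<in> A\<close> by (intro Max_ge) auto
    ultimately show False by simp
  qed
  have inj: "inj_on E_seq A"
  proof (rule linorder_inj_onI)
    fix x y assume "x < y" "x \<in> A" "y \<in> A"
    then show "E_seq x \<noteq> E_seq y" using E_seq_strict_mono[of x y] by (simp add: A_def)
  qed auto
  \<comment> \<open>\<open>N_count\<close> counts values rather than indices: by injectivity,
    \<open>Z\<close> indices in \<open>A\<close> give \<open>Z\<close> distinct values, all counted
    once \<open>x\<close> reaches the largest.\<close>
  have "eventually (\<lambda>x. Z \<le> N_count x q [a, b, c]) at_top" for Z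
  proof -
    obtain F where F: "F \<subseteq> A" "finite F" "card F = Z"
      using \<open>infinite A\<close> infinite_arbitrarily_large by blast
    have "Z \<le> N_count x q [a, b, c]" if x: "x \<ge> real (Max (E_seq ` F))" for x
    proof -
      define S where "S = {E_seq n | n. 1 \<le> n \<and> real (E_seq n) \<le> x \<and>
        (\<forall>i\<in>{1..length [a, b, c]}. [int (E_seq (n + i - 1)) = [a, b, c] ! (i - 1)] (mod int q))}"
      have "S \<subseteq> {..nat \<lfloor>x\<rfloor>}" unfolding S_def by (auto simp: le_nat_floor)
      then have "finite S" using finite_subset by blast
      moreover have "E_seq ` F \<subseteq> S"
      proof
        fix e assume "e \<in> E_seq ` F"
        then obtain n where n: "n \<in> F" "e = E_seq n" by blast
        have "E_seq n \<le> Max (E_seq ` F)" using n F(2) by (intro Max_ge) auto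
        then have "real (E_seq n) \<le> x" using x by linarith
        moreover have "[int (E_seq (n + i - 1)) = [a, b, c] ! (i - 1)] (mod int q)"
          if "i \<in> {1..length [a, b, c]}" for i
        proof -
          have "i = 1 \<or> i = 2 \<or> i = 3" using that by auto
          then show ?thesis using n(1) F(1) by (auto simp: A_def numeral_3_eq_3)
        qed
        ultimately show "e \<in> S" using n F(1) unfolding S_def A_def by blast
      qed
      ultimately have "card (E_seq ` F) \<le> card S" by (rule card_mono)
      moreover have "card (E_seq ` F) = Z"
        using F inj by (metis card_image inj_on_subset)
      ultimately show ?thesis unfolding N_count_def S_def by simp
    qed
    then show ?thesis unfolding eventually_at_top_linorder by blast
  qed
  then show ?thesis using \<open>infinite A\<close> unfolding A_def filterlim_at_top by blast
qed

end
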